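(* Let $W\subseteq\mathbb{R}^n$ be a linear subspace and $c,d\in\mathbb{R}^n$. Let $(\tilde x,s)$ be an optimal primal-dual solution pair to $\mathrm{LP}(W,\tilde x,c)$, and let $R=\{i\in[n]:\ \tilde x_i>(\kappa_W+1)\|\Pi_{W^\perp}(\tilde x-d)\|_1\}$. Then every dual optimal solution $s^*$ to $\mathrm{LP}(W,d,c)$ satisfies $s^*_R=0$.
   Context: For a subspace $W$ and $d,c\in\mathbb{R}^n$, $\mathrm{LP}(W,d,c)$ is the primal-dual pair: primal $\min\{c^\top x:\ x\in W+d,\ x\ge0\}$, dual $\max\{(c-s)^\top d:\ s\in W^\perp+c,\ s\ge0\}$. $\Pi_{W^\perp}$ is the orthogonal projection onto $W^\perp$. An elementary vector of $W$ is a nonzero $g\in W$ with inclusion-minimal support among nonzero vectors of $W$; $\kappa_W=\max\{|g_j/g_i|: g\text{ elementary},\ i,j\in\mathrm{supp}(g)\}$ for nontrivial $W$, and $\kappa_W=1$ for $W\in\{\{0\},\mathbb{R}^n\}$. *)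

theory Defs
  imports "HOL-Analysis.Analysis"
begin

definition lp_primal_feasible :: "(real ^ 'n) set \<Rightarrow> real ^ 'n \<Rightarrow> (real ^ 'n) set" where
  "lp_primal_feasible W d = {x. x \<in> (\<lambda>w. w + d) ` W \<and> (\<forall>i. 0 \<le> x $ i)}"

definition lp_dual_feasible :: "(real ^ 'n) set \<Rightarrow> real ^ 'n \<Rightarrow> (real ^ 'n) set" where
  "lp_dual_feasible W c = {s. s \<in> (\<lambda>u. u + c) ` (W\<^sup>\<bottom>) \<and> (\<forall>i. 0 \<le> s $ i)}"

definition lp_primal_optimal ::
    "(real ^ 'n) set \<Rightarrow> real ^ 'n \<Rightarrow> real ^ 'n \<Rightarrow> real ^ 'n \<Rightarrow> bool" where
  "lp_primal_optimal W d c x \<longleftrightarrow>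
     x \<in> lp_primal_feasible W d \<and> (\<forall>y \<in> lp_primal_feasible W d. c \<bullet> x \<le> c \<bullet> y)"

definition lp_dual_optimal ::
    "(real ^ 'n) set \<Rightarrow> real ^ 'n \<Rightarrow> real ^ 'n \<Rightarrow> real ^ 'n \<Rightarrow> bool" where
  "lp_dual_optimal W d c s \<longleftrightarrow>
     s \<in> lp_dual_feasible W c \<and> (\<forall>t \<in> lp_dual_feasible W c. (c - t) \<bullet> d \<le> (c - s) \<bullet> d)"

definition orth_proj :: "(real ^ 'n) set \<Rightarrow> real ^ 'n \<Rightarrow> real ^ 'n" where
  "orth_proj U x = (THE p. p \<in> U \<and> x - p \<in> U\<^sup>\<bottom>)"

definition norm_l1 :: "real ^ 'n \<Rightarrow> real" where
  "norm_l1 x = (\<Sum>i\<in>UNIV. \<bar>x $ i\<bar>)"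

definition vsupp :: "real ^ 'n \<Rightarrow> 'n set" where
  "vsupp x = {i. x $ i \<noteq> 0}"

definition elementary_vector :: "(real ^ 'n) set \<Rightarrow> real ^ 'n \<Rightarrow> bool" where
  "elementary_vector W g \<longleftrightarrow>
     g \<in> W \<and> g \<noteq> 0 \<and> (\<forall>h \<in> W. h \<noteq> 0 \<longrightarrow> \<not> vsupp h \<subset> vsupp g)"

definition elementary_ratios :: "(real ^ 'n) set \<Rightarrow> real set" where
  "elementary_ratios W =
     {\<bar>g $ j / g $ i\<bar> | g i j. elementary_vector W g \<and> i \<in> vsupp g \<and> j \<in> vsupp g}"

definition kappa :: "(real ^ 'n) set \<Rightarrow> real" where
  "kappa W = (if W = {0} \<or> W = UNIV then 1 else Max (elementary_ratios W))"

text \<open>The description in \<open>orth_proj\<close> determines a unique vector, and the maximum in \<open>kappa\<close>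
  is taken over a finite nonempty set.\<close>

lemma orth_proj_ex1:
  fixes U :: "(real ^ 'n) set"
  assumes "subspace U"
  shows "\<exists>!p. p \<in> U \<and> x - p \<in> U\<^sup>\<bottom>"
proof (rule ex_ex1I)
  have span: "span U = U" using assms by (simp add: span_eq_iff)
  obtain y z where "y \<in> U" "\<And>w. w \<in> U \<Longrightarrow> orthogonal z w" "x = y + z"
    using orthogonal_subspace_decomp_exists[of U x] unfolding span by blast
  then show "\<exists>p. p \<in> U \<and> x - p \<in> U\<^sup>\<bottom>"
    by (intro exI[of _ y]) (auto simp: orthogonal_comp_def orthogonal_commute)
next
  fix p q assume p: "p \<in> U \<and> x - p \<in> U\<^sup>\<bottom>" and q: "q \<in> U \<and> x - q \<in> U\<^sup>\<bottom>"
  have d: "p - q \<in> U" using p q assms by (simp add: subspace_diff)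
  then have "(p - q) \<bullet> (x - q) = 0" "(p - q) \<bullet> (x - p) = 0"
    using p q by (auto simp: orthogonal_comp_def orthogonal_def)
  then have "(p - q) \<bullet> (p - q) = 0" by (simp add: inner_diff_right)
  then show "p = q" by simp
qed

lemma elementary_vectors_proportional:
  fixes W :: "(real ^ 'n) set"
  assumes W: "subspace W" and g: "elementary_vector W g" and h: "elementary_vector W h"
    and eq: "vsupp g = vsupp h"
  shows "\<exists>a. a \<noteq> 0 \<and> h = a *\<^sub>R g"
proof -
  obtain i where i: "g $ i \<noteq> 0" using g by (auto simp: elementary_vector_def vec_eq_iff)
  then have hi: "h $ i \<noteq> 0" using eq by (auto simp: vsupp_def)
  define a where "a = h $ i / g $ i"
  have a: "a \<noteq> 0" using i hi by (simp add: a_def)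
  define v where "v = h - a *\<^sub>R g"
  have vW: "v \<in> W" using W g h
    by (simp add: v_def elementary_vector_def subspace_diff subspace_scale)
  have "v $ i = 0" using i by (simp add: v_def a_def)
  moreover have "v $ j = 0" if "g $ j = 0" for j
    using that eq by (auto simp: v_def vsupp_def)
  ultimately have "vsupp v \<subset> vsupp g" using i by (auto simp: vsupp_def)
  then have "v = 0" using vW g by (auto simp: elementary_vector_def)
  then show ?thesis using a by (auto simp: v_def)
qed

lemma finite_elementary_ratios:
  fixes W :: "(real ^ 'n) set"
  assumes W: "subspace W"
  shows "finite (elementary_ratios W)"
proof -
  define e where "e S = (SOME g. elementary_vector W g \<and> vsupp g = S)" for S
  have "elementary_ratios W \<subseteq> range (\<lambda>(S, i, j). \<bar>e S $ j / e S $ i\<bar>)"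
  proof
    fix r assume "r \<in> elementary_ratios W"
    then obtain g i j where r: "r = \<bar>g $ j / g $ i\<bar>" and g: "elementary_vector W g"
      by (auto simp: elementary_ratios_def)
    define h where "h = e (vsupp g)"
    have h: "elementary_vector W h \<and> vsupp h = vsupp g"
      unfolding h_def e_def by (rule someI[of _ g]) (use g in simp)
    then obtain a where a: "a \<noteq> 0" and ga: "g = a *\<^sub>R h"
      using elementary_vectors_proportional[OF W, of h g] g by blast
    then have "g $ j / g $ i = h $ j / h $ i"
      by simp
    then have "r = (\<lambda>(S, i, j). \<bar>e S $ j / e S $ i\<bar>) (vsupp g, i, j)"
      using r by (simp only: h_def split_conv)
    then show "r \<in> range (\<lambda>(S, i, j). \<bar>e S $ j / e S $ i\<bar>)" by (rule range_eqI)
  qed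
  then show ?thesis by (rule finite_subset) simp
qed

lemma elementary_ratios_nonempty:
  fixes W :: "(real ^ 'n) set"
  assumes W: "subspace W" and "W \<noteq> {0}"
  shows "elementary_ratios W \<noteq> {}"
proof -
  obtain w where "w \<in> W \<and> w \<noteq> 0" using assms subspace_0 by blast
  then obtain g where g: "g \<in> W \<and> g \<noteq> 0"
    and min: "\<And>h. h \<in> W \<and> h \<noteq> 0 \<Longrightarrow> card (vsupp g) \<le> card (vsupp h)"
    using ex_has_least_nat[of "\<lambda>w. w \<in> W \<and> w \<noteq> 0" w "\<lambda>w. card (vsupp w)"] by blast
  have "\<not> vsupp h \<subset> vsupp g" if "h \<in> W" "h \<noteq> 0" for h
    using min[of h] that psubset_card_mono[of "vsupp g" "vsupp h"] by auto
  then have "elementary_vector W g" using g by (auto simp: elementary_vector_def)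
  moreover obtain i where "i \<in> vsupp g" using g by (auto simp: vsupp_def vec_eq_iff)
  ultimately show ?thesis unfolding elementary_ratios_def by blast
qed

end

theory Submission
  imports Defs
begin

text \<open>Let \<open>s'\<close> be dual optimal for \<open>LP(W,d,c)\<close> with \<open>s'\<^sub>i > 0\<close> for some \<open>i \<in> R\<close>. Complementary slackness
  for \<open>LP(W,x,c)\<close>, with \<open>x\<close> written for \<open>xt\<close>, gives \<open>s\<^sub>i = 0\<close>, so \<open>s' - s \<in> W\<^sup>\<bottom>\<close> is positive at \<open>i\<close> and dominates,
  coordinatewise and with the same signs, an elementary vector \<open>h\<close> of \<open>W\<^sup>\<bottom>\<close> with \<open>h\<^sub>i > 0\<close>. Then \<open>s' - h\<close> is
  dual feasible. Where \<open>h\<close> is negative, \<open>s\<close> is positive and \<open>x\<close> vanishes, whence \<open>h \<bullet> x \<ge> h\<^sub>i x\<^sub>i\<close>;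
  and \<open>h \<bullet> (x - d)\<close> is at most \<open>\<kappa> h\<^sub>i\<close> times the 1-norm of the projection of \<open>x - d\<close>, because the entry
  ratios of elementary vectors of \<open>W\<^sup>\<bottom>\<close> are also bounded by \<open>\<kappa>\<close> of \<open>W\<close>. Hence \<open>h \<bullet> d > 0\<close>, and \<open>s' - h\<close>
  improves on \<open>s'\<close>.\<close>

section \<open>Inner products: orthogonality and a bound by the 1-norm\<close>

lemma orthogonal_compD: "x \<in> W\<^sup>\<bottom> \<Longrightarrow> w \<in> W \<Longrightarrow> x \<bullet> w = 0"
  by (auto simp: orthogonal_comp_def orthogonal_def inner_commute)

lemma inner_le_norm_l1:
  fixes h p :: "real ^ 'n"
  assumes "\<And>k. \<bar>h $ k\<bar> \<le> M"
  shows "h \<bullet> p \<le> M * norm_l1 p"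
proof -
  have "h \<bullet> p \<le> (\<Sum>k\<in>UNIV. M * \<bar>p $ k\<bar>)"
    unfolding inner_vec_def inner_real_def
  proof (rule sum_mono)
    fix k
    have "h $ k * p $ k \<le> \<bar>h $ k\<bar> * \<bar>p $ k\<bar>" by (metis abs_ge_self abs_mult)
    also have "\<dots> \<le> M * \<bar>p $ k\<bar>" using assms by (intro mult_right_mono) auto
    finally show "h $ k * p $ k \<le> M * \<bar>p $ k\<bar>" .
  qed
  then show ?thesis by (simp add: norm_l1_def sum_distrib_left)
qed

section \<open>Conformal elementary vectors\<close>

text \<open>Sign compatibility. Where \<open>v\<close> vanishes the product condition says nothing,
  so the second clause puts the support of \<open>g\<close> inside that of \<open>v\<close>.\<close>

definition conformal :: "real ^ 'n \<Rightarrow> real ^ 'n \<Rightarrow> bool" where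
  "conformal g v \<longleftrightarrow> (\<forall>k. 0 \<le> g $ k * v $ k \<and> (v $ k = 0 \<longrightarrow> g $ k = 0))"

lemma conformal_trans:
  assumes "conformal f g" "conformal g v"
  shows "conformal f v"
  unfolding conformal_def
proof (intro allI conjI impI)
  fix k
  show "v $ k = 0 \<Longrightarrow> f $ k = 0"
    using assms by (auto simp: conformal_def)
  have "0 \<le> f $ k * g $ k" "0 \<le> g $ k * v $ k" "g $ k = 0 \<Longrightarrow> f $ k = 0"
    using assms by (auto simp: conformal_def)
  then show "0 \<le> f $ k * v $ k"
    by (auto simp: zero_le_mult_iff)
qed

lemma conformal_supp: "conformal g v \<Longrightarrow> vsupp g \<subseteq> vsupp v"
  by (auto simp: conformal_def vsupp_def)

text \<open>A ratio test: \<open>t\<close> is the largest step at which no entry of \<open>h\<close>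
  has changed sign, and an entry attaining the minimum becomes zero. Only coordinates where
  \<open>q\<close> and \<open>h\<close> agree in sign limit the step.\<close>

lemma conformal_eliminate:
  fixes h q :: "real ^ 'n"
  assumes sub: "vsupp q \<subseteq> vsupp h" and k: "q $ k * h $ k > 0"
  obtains t where "t > 0" "conformal (h - t *\<^sub>R q) h" "vsupp (h - t *\<^sub>R q) \<subset> vsupp h"
proof -
  define P where "P = {k. q $ k * h $ k > 0}"
  define t where "t = Min ((\<lambda>k. h $ k / q $ k) ` P)"
  have P: "finite P" "P \<noteq> {}"
    using k by (auto simp: P_def)
  have "t \<in> (\<lambda>k. h $ k / q $ k) ` P"
    unfolding t_def using P by (intro Min_in) auto
  then obtain m where m: "m \<in> P" "t = h $ m / q $ m" by auto
  have le: "t \<le> h $ k / q $ k" if "k \<in> P" for k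
    unfolding t_def using P that by auto
  have t: "t > 0"
    using m by (auto simp: P_def zero_less_mult_iff zero_less_divide_iff)
  have "conformal (h - t *\<^sub>R q) h"
    unfolding conformal_def
  proof (intro allI conjI impI)
    fix k
    show "h $ k = 0 \<Longrightarrow> (h - t *\<^sub>R q) $ k = 0"
      using sub by (auto simp: vsupp_def)
    have "t * (q $ k * h $ k) \<le> h $ k * h $ k"
    proof (cases "k \<in> P")
      case True
      then have "q $ k \<noteq> 0" "0 \<le> q $ k * h $ k" by (auto simp: P_def)
      then have "t * (q $ k * h $ k) \<le> h $ k / q $ k * (q $ k * h $ k)"
        using le[OF True] by (intro mult_right_mono)
      then show ?thesis using \<open>q $ k \<noteq> 0\<close> by simp
    next
      case False
      then have "t * (q $ k * h $ k) \<le> 0"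
        using t by (auto simp: P_def mult_le_0_iff not_less)
      then show ?thesis
        by (meson order_trans zero_le_square)
    qed
    then show "0 \<le> (h - t *\<^sub>R q) $ k * h $ k"
      by (simp add: algebra_simps)
  qed
  moreover have "m \<in> vsupp h" "m \<notin> vsupp (h - t *\<^sub>R q)"
    using m by (auto simp: P_def vsupp_def)
  ultimately show thesis
    using that t conformal_supp by blast
qed

text \<open>Among the vectors of \<open>W\<close> conformal to \<open>v\<close> and nonzero at
  \<open>i\<close>, one of least support is already elementary: a nonzero vector of \<open>W\<close>
  with smaller support would lead to a smaller candidate.\<close>

lemma ex_conformal_elementary:
  fixes W :: "(real ^ 'n) set"
  assumes W: "subspace W" and v: "v \<in> W" "v $ i \<noteq> 0"
  obtains h where "elementary_vector W h" "conformal h v" "h $ i \<noteq> 0"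
proof -
  define Q where "Q h \<longleftrightarrow> h \<in> W \<and> conformal h v \<and> h $ i \<noteq> 0" for h
  have "Q v" using v by (auto simp: Q_def conformal_def)
  then obtain h where h: "Q h" and min: "\<And>g. Q g \<Longrightarrow> card (vsupp h) \<le> card (vsupp g)"
    using ex_has_least_nat[of Q v "\<lambda>h. card (vsupp h)"] by blast
  have smaller: "g $ i = 0" if "g \<in> W" "conformal g h" "vsupp g \<subset> vsupp h" for g
  proof (rule ccontr)
    assume "g $ i \<noteq> 0"
    then have "Q g" using that h conformal_trans by (auto simp: Q_def)
    then show False
      using min[of g] psubset_card_mono[OF _ that(3)] by auto
  qed
  \<comment> \<open>Elimination by such a \<open>q\<close> shrinks the support, while
    \<open>q $ i * h $ i \<le> 0\<close> keeps entry \<open>i\<close> from vanishing.\<close>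
  have no: False
    if q: "q \<in> W" "vsupp q \<subset> vsupp h" "q $ i * h $ i \<le> 0" and k: "q $ k * h $ k > 0" for q k
  proof -
    obtain t where t: "t > 0" "conformal (h - t *\<^sub>R q) h" "vsupp (h - t *\<^sub>R q) \<subset> vsupp h"
      using conformal_eliminate[of q h k] q k by blast
    have "h - t *\<^sub>R q \<in> W"
      using W q h by (auto simp: Q_def subspace_diff subspace_scale)
    then have "(h - t *\<^sub>R q) $ i = 0" using smaller t by blast
    then have "h $ i * h $ i = t * (q $ i * h $ i)" by simp
    also have "\<dots> \<le> 0" using t q by (simp add: mult_le_0_iff)
    finally have "h $ i = 0"
      by (metis mult_eq_0_iff order_antisym zero_le_square)
    then show False using h by (simp add: Q_def)
  qed
  have "\<not> vsupp q \<subset> vsupp h" if q: "q \<in> W" "q \<noteq> 0" for q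
  proof
    assume sub: "vsupp q \<subset> vsupp h"
    obtain k where k: "q $ k * h $ k \<noteq> 0"
      using q sub by (auto simp: vsupp_def vec_eq_iff)
    have "vsupp (- q) = vsupp q" by (simp add: vsupp_def)
    with sub have neg: "- q \<in> W" "vsupp (- q) \<subset> vsupp h"
      using W q by (auto simp: subspace_neg)
    \<comment> \<open>By \<open>no\<close>, a \<open>p\<close> opposite to \<open>h\<close> at
      \<open>i\<close> agrees in sign with \<open>h\<close> nowhere, so \<open>- p\<close> is itself
      a smaller candidate.\<close>
    have wlog: False
      if p: "p \<in> W" "vsupp p \<subset> vsupp h" "p $ i * h $ i < 0" for p
    proof -
      have "p $ k * h $ k \<le> 0" for k
        using no[of p k] p by fastforce
      then have "conformal (- p) h" "- p \<in> W" "vsupp (- p) \<subset> vsupp h"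
        using p W by (auto simp: conformal_def subspace_neg vsupp_def)
      then have "(- p) $ i = 0" by (intro smaller)
      then show False using p by simp
    qed
    show False
    \<comment> \<open>If \<open>q\<close> vanishes at \<open>i\<close>, then \<open>no\<close>
      admits both \<open>q\<close> and \<open>- q\<close>, and entry \<open>k\<close> decides
      between them. Otherwise entry \<open>i\<close> decides which one goes into
      \<open>wlog\<close>.\<close>
    proof (cases "q $ i * h $ i = 0")
      case True
      then have le: "q $ i * h $ i \<le> 0" "(- q) $ i * h $ i \<le> 0"
        by auto
      from k consider "q $ k * h $ k > 0" | "q $ k * h $ k < 0" by linarith
      then show False
      proof cases
        case 1
        then show False by (rule no[OF q(1) sub le(1)])
      next
        case 2
        then have "(- q) $ k * h $ k > 0" by simp
        then show False by (rule no[OF neg le(2)])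
      qed
    next
      case False
      then consider "q $ i * h $ i < 0" | "q $ i * h $ i > 0" by linarith
      then show False
      proof cases
        case 1
        then show False by (rule wlog[OF q(1) sub])
      next
        case 2
        then have "(- q) $ i * h $ i < 0" by simp
        then show False by (rule wlog[OF neg])
      qed
    qed
  qed
  then have "elementary_vector W h"
    using h by (auto simp: elementary_vector_def Q_def)
  then show thesis using that h by (auto simp: Q_def)
qed

text \<open>Scaling a conformal elementary vector by its elimination step against \<open>v\<close>
  puts each entry between 0 and that of \<open>v\<close>. The bound by \<open>max (v $ k) 0\<close>
  is the form that later makes \<open>s' - h\<close> nonnegative.\<close>

lemma ex_dominated_conformal_elementary:
  fixes W :: "(real ^ 'n) set"
  assumes W: "subspace W" and v: "v \<in> W" "v $ i > 0"
  obtains h where "elementary_vector W h" "h $ i > 0"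
    "\<And>k. h $ k \<le> max (v $ k) 0" "\<And>k. h $ k < 0 \<Longrightarrow> v $ k < 0"
proof -
  obtain g where g: "elementary_vector W g" "conformal g v" "g $ i \<noteq> 0"
    using ex_conformal_elementary[OF W, of v i] v by auto
  have gi: "g $ i > 0"
    using g v by (auto simp: conformal_def zero_le_mult_iff less_le dest!: spec[of _ i])
  then obtain t where t: "t > 0" "conformal (v - t *\<^sub>R g) v"
    using conformal_eliminate[of g v i] conformal_supp[OF g(2)] v by (metis mult_pos_pos)
  have supp: "vsupp (t *\<^sub>R g) = vsupp g" using t by (auto simp: vsupp_def)
  have "elementary_vector W (t *\<^sub>R g)"
    using g t W supp by (auto simp: elementary_vector_def subspace_scale)
  moreover have "(t *\<^sub>R g) $ k \<le> max (v $ k) 0" for k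
  proof -
    have "0 \<le> g $ k * v $ k" "v $ k = 0 \<Longrightarrow> g $ k = 0" "0 \<le> (v $ k - t * g $ k) * v $ k"
      using g t by (auto simp: conformal_def)
    then show ?thesis using t
      by (auto simp: zero_le_mult_iff max_def mult_le_0_iff)
  qed
  moreover have "v $ k < 0" if "(t *\<^sub>R g) $ k < 0" for k
  proof -
    have "g $ k < 0" using that t by (simp add: mult_less_0_iff)
    moreover have "0 \<le> g $ k * v $ k" "v $ k = 0 \<Longrightarrow> g $ k = 0"
      using g by (auto simp: conformal_def)
    ultimately show ?thesis by (auto simp: zero_le_mult_iff less_le)
  qed
  ultimately show thesis using that[of "t *\<^sub>R g"] gi t by simp
qed

section \<open>Entry ratios of elementary vectors of the orthogonal complement\<close>

lemma elementary_ratio_le_kappa: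
  fixes W :: "(real ^ 'n) set"
  assumes "subspace W" "W \<noteq> UNIV" "elementary_vector W g" "i \<in> vsupp g" "j \<in> vsupp g"
  shows "\<bar>g $ j / g $ i\<bar> \<le> kappa W"
proof -
  have "W \<noteq> {0}" using assms by (auto simp: elementary_vector_def)
  moreover have "\<bar>g $ j / g $ i\<bar> \<in> elementary_ratios W"
    using assms unfolding elementary_ratios_def by blast
  ultimately show ?thesis
    using assms finite_elementary_ratios[of W] by (simp add: kappa_def)
qed

lemma one_le_kappa:
  fixes W :: "(real ^ 'n) set"
  assumes W: "subspace W"
  shows "1 \<le> kappa W"
proof (cases "W = {0} \<or> W = UNIV")
  case False
  then obtain g i j where "elementary_vector W g" "i \<in> vsupp g"
    using elementary_ratios_nonempty[OF W] by (auto simp: elementary_ratios_def)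
  then show ?thesis
    using elementary_ratio_le_kappa[of W g i i] W False by (auto simp: vsupp_def)
qed (simp add: kappa_def)

text \<open>A vector orthogonal to both \<open>W\<close> and the coordinates outside \<open>vsupp h\<close> is a multiple of \<open>h\<close>,
  so the restriction of \<open>W\<close> to \<open>vsupp h\<close> is all of the hyperplane orthogonal to \<open>h\<close>.\<close>

lemma ex_extension_orthogonal_elementary:
  fixes W :: "(real ^ 'n) set"
  assumes W: "subspace W" and h: "elementary_vector (W\<^sup>\<bottom>) h" and x: "h \<bullet> x = 0"
  obtains w where "w \<in> W" "\<And>k. k \<in> vsupp h \<Longrightarrow> w $ k = x $ k"
proof -
  \<comment> \<open>Membership of \<open>x\<close> in \<open>U = W + E\<close> means exactly that
    some vector of \<open>W\<close> agrees with \<open>x\<close> on \<open>vsupp h\<close>. It is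
    proved by showing that the component \<open>z\<close> of \<open>x\<close> orthogonal to
    \<open>U\<close> is zero.\<close>
  define E where "E = {u :: real ^ 'n. \<forall>k\<in>vsupp h. u $ k = 0}"
  define U where "U = {w + u |w u. w \<in> W \<and> u \<in> E}"
  have E: "subspace E" by (auto simp: E_def subspace_def)
  have U: "subspace U" unfolding U_def by (rule subspace_sums[OF W E])
  define y where "y = orth_proj U x"
  have y: "y \<in> U" "x - y \<in> U\<^sup>\<bottom>"
    using theI'[OF orth_proj_ex1[OF U, of x]] by (auto simp: y_def orth_proj_def)
  define z where "z = x - y"
  have "w + 0 \<in> U" if "w \<in> W" for w
    unfolding U_def using that subspace_0[OF E] by blast
  then have "W \<subseteq> U" by auto
  then have zW: "z \<in> W\<^sup>\<bottom>"
    using y orthogonal_comp_anti_mono[of W U] by (auto simp: z_def)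
  have "z $ k = 0" if "k \<notin> vsupp h" for k
  proof -
    have "axis k 1 \<in> E" using that by (auto simp: E_def axis_def)
    then have "0 + axis k 1 \<in> U"
      unfolding U_def using subspace_0[OF W] by blast
    then have "z \<bullet> axis k 1 = 0" using y orthogonal_compD by (auto simp: z_def)
    then show ?thesis by (simp add: inner_axis)
  qed
  then have sub: "vsupp z \<subseteq> vsupp h" by (auto simp: vsupp_def)
  \<comment> \<open>By minimality of \<open>vsupp h\<close>, either \<open>z = 0\<close> or
    \<open>z\<close> has the same support as \<open>h\<close> and is a multiple of it.\<close>
  have "z \<bullet> x = 0"
  proof (cases "z = 0")
    case False
    have hmin: "\<And>q. q \<in> W\<^sup>\<bottom> \<Longrightarrow> q \<noteq> 0 \<Longrightarrow> \<not> vsupp q \<subset> vsupp h"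
      using h by (auto simp: elementary_vector_def)
    then have "vsupp z = vsupp h" using zW False sub by blast
    moreover from this have "elementary_vector (W\<^sup>\<bottom>) z"
      using zW False hmin by (auto simp: elementary_vector_def)
    ultimately obtain a where "z = a *\<^sub>R h"
      using elementary_vectors_proportional[OF subspace_orthogonal_comp h] by metis
    then show ?thesis using x by simp
  qed simp
  moreover have "z \<bullet> y = 0" using y orthogonal_compD by (auto simp: z_def)
  ultimately have "z \<bullet> z = 0" by (simp add: z_def inner_diff_right)
  then have "x \<in> U" using y by (simp add: z_def)
  then obtain w u where "w \<in> W" "u \<in> E" "x = w + u" by (auto simp: U_def)
  then show thesis using that[of w] by (auto simp: E_def)
qed

text \<open>One half of the self-duality of \<open>kappa\<close>. A vector orthogonal to
  \<open>h\<close> and supported on \<open>i\<close> and \<open>j\<close> extends from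
  \<open>vsupp h\<close> to a vector of \<open>W\<close>. An elementary vector \<open>g\<close> of
  \<open>W\<close> conformal to it meets \<open>vsupp h\<close> only in \<open>i\<close> and
  \<open>j\<close>, so \<open>h \<bullet> g = 0\<close> has two terms and turns the ratio of
  \<open>h\<close> into an inverse ratio of \<open>g\<close>.\<close>

lemma elementary_ratio_orthogonal_comp_le_kappa:
  fixes W :: "(real ^ 'n) set"
  assumes W: "subspace W" and h: "elementary_vector (W\<^sup>\<bottom>) h"
    and i: "i \<in> vsupp h" and j: "j \<in> vsupp h"
  shows "\<bar>h $ j / h $ i\<bar> \<le> kappa W"
proof (cases "i = j")
  case True
  then show ?thesis using one_le_kappa[OF W] i by (simp add: vsupp_def)
next
  case False
  define x where "x = axis i (h $ j) - axis j (h $ i)"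
  have "h \<bullet> x = 0" by (simp add: x_def inner_diff_right inner_axis)
  then obtain w where w: "w \<in> W" "\<And>k. k \<in> vsupp h \<Longrightarrow> w $ k = x $ k"
    using ex_extension_orthogonal_elementary[OF W h] by metis
  have "w $ i \<noteq> 0" using w i j False by (auto simp: x_def axis_def vsupp_def)
  then obtain g where g: "elementary_vector W g" "conformal g w" "g $ i \<noteq> 0"
    using ex_conformal_elementary[OF W w(1)] by blast
  have zero: "h $ k * g $ k = 0" if "k \<noteq> i" "k \<noteq> j" for k
  proof (cases "k \<in> vsupp h")
    case True
    then have "w $ k = 0" using w(2) that by (simp add: x_def axis_def)
    then show ?thesis using g by (auto simp: conformal_def)
  qed (simp add: vsupp_def)
  have "h \<bullet> g = 0"
    using g h orthogonal_compD by (auto simp: elementary_vector_def)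
  also have "h \<bullet> g = (\<Sum>k\<in>{i, j}. h $ k * g $ k)"
    unfolding inner_vec_def inner_real_def
    by (rule sum.mono_neutral_right) (use zero in auto)
  finally have eq: "h $ i * g $ i = - (h $ j * g $ j)" using False by simp
  then have gj: "g $ j \<noteq> 0" using g i by (auto simp: vsupp_def)
  have "h $ i \<noteq> 0" using i by (simp add: vsupp_def)
  with eq gj have "h $ j / h $ i = - (g $ i / g $ j)"
    by (simp add: field_simps)
  then have "\<bar>h $ j / h $ i\<bar> = \<bar>g $ i / g $ j\<bar>" by simp
  moreover have "W \<noteq> UNIV" using h by (auto simp: elementary_vector_def)
  ultimately show ?thesis
    using elementary_ratio_le_kappa[of W g j i] W g gj by (simp add: vsupp_def)
qed

section \<open>Complementary slackness\<close>

text \<open>If \<open>c\<close> were outside the closed cone \<open>W\<^sup>\<bottom> + N\<close>, a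
  separating normal \<open>a\<close> would lie in \<open>W\<close>, be nonnegative on
  \<open>J\<close> and satisfy \<open>c \<bullet> a < 0\<close>.\<close>

lemma farkas_subspace:
  fixes W :: "(real ^ 'n) set"
  assumes W: "subspace W"
    and c: "\<And>w. w \<in> W \<Longrightarrow> (\<And>j. j \<in> J \<Longrightarrow> 0 \<le> w $ j) \<Longrightarrow> 0 \<le> c \<bullet> w"
  obtains u where "u \<in> W\<^sup>\<bottom>" "\<And>j. j \<in> J \<Longrightarrow> 0 \<le> (u + c) $ j" "\<And>j. j \<notin> J \<Longrightarrow> (u + c) $ j = 0"
proof -
  define N where "N = {x :: real ^ 'n. (\<forall>j\<in>J. 0 \<le> x $ j) \<and> (\<forall>j. j \<notin> J \<longrightarrow> x $ j = 0)}"
  define A where "A = (\<lambda>j. axis j 1 :: real ^ 'n) ` J"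
  obtain B where B: "B \<subseteq> W\<^sup>\<bottom>" "finite B" "W\<^sup>\<bottom> \<subseteq> span B"
    using basis_exists[of "W\<^sup>\<bottom>"] independent_imp_finite by metis
  \<comment> \<open>Including the negatives makes the cone over \<open>B\<close> the whole of
    \<open>W\<^sup>\<bottom>\<close>; finiteness of \<open>G\<close> makes \<open>K\<close>
    closed.\<close>
  define G where "G = B \<union> uminus ` B \<union> A"
  define K where "K = convex_cone hull G"
  have K: "convex_cone K" "closed K"
    using B by (auto simp: K_def G_def A_def convex_cone_convex_cone_hull intro!: closed_convex_cone_hull)
  have GK: "G \<subseteq> K" unfolding K_def by (rule hull_subset)
  have "c \<in> K"
  proof (rule ccontr)
    assume "c \<notin> K"
    then obtain a b where ab: "a \<bullet> c < b" "\<And>x. x \<in> K \<Longrightarrow> b < a \<bullet> x"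
      using separating_hyperplane_closed_point[of K c] K by (auto simp: convex_cone_def)
    have b: "b < 0" using ab(2)[of 0] K convex_cone_contains_0 by auto
    have pos: "0 \<le> a \<bullet> x" if "x \<in> K" for x
    proof (rule ccontr)
      assume neg: "\<not> 0 \<le> a \<bullet> x"
      \<comment> \<open>This multiple of \<open>x\<close> has inner product exactly \<open>b\<close>
        with \<open>a\<close>, against the strict separation.\<close>
      then have "(b / (a \<bullet> x)) *\<^sub>R x \<in> K"
        using b that K by (intro convex_cone_scaleR) (auto simp: divide_nonpos_neg)
      from ab(2)[OF this] neg show False by simp
    qed
    have "a \<bullet> x = 0" if "x \<in> B" for x
    proof -
      have "x \<in> K" "- x \<in> K" using that GK by (auto simp: G_def)
      from this[THEN pos] show ?thesis by simp
    qed
    then have "span B \<subseteq> {x. a \<bullet> x = 0}"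
      by (intro span_minimal subspace_hyperplane) auto
    then have "a \<in> W\<^sup>\<bottom>\<^sup>\<bottom>"
      using B by (auto simp: orthogonal_comp_def orthogonal_def inner_commute)
    then have "a \<in> W" using orthogonal_comp_self[OF W] by simp
    moreover have "0 \<le> a $ j" if "j \<in> J" for j
      using pos[of "axis j 1"] GK that by (auto simp: G_def A_def inner_axis)
    ultimately have "0 \<le> c \<bullet> a" by (rule c)
    then show False using ab(1) b by (simp add: inner_commute)
  qed
  moreover have "K \<subseteq> (\<Union>u\<in>W\<^sup>\<bottom>. \<Union>x\<in>N. {u + x})"
    unfolding K_def
  proof (rule hull_minimal)
    have N: "convex_cone N" by (auto simp: N_def convex_cone_iff)
    show "convex_cone (\<Union>u\<in>W\<^sup>\<bottom>. \<Union>x\<in>N. {u + x})"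
      by (rule convex_cone_sums[OF subspace_imp_convex_cone[OF subspace_orthogonal_comp] N])
    have sum: "u + x \<in> (\<Union>u\<in>W\<^sup>\<bottom>. \<Union>x\<in>N. {u + x})" if "u \<in> W\<^sup>\<bottom>" "x \<in> N" for u x
      using that by blast
    have "W\<^sup>\<bottom> \<subseteq> (\<Union>u\<in>W\<^sup>\<bottom>. \<Union>x\<in>N. {u + x})"
    proof
      fix u assume "u \<in> W\<^sup>\<bottom>"
      from sum[OF this, of 0] show "u \<in> (\<Union>u\<in>W\<^sup>\<bottom>. \<Union>x\<in>N. {u + x})"
        by (simp add: N_def)
    qed
    moreover have "B \<union> uminus ` B \<subseteq> W\<^sup>\<bottom>"
      using B subspace_orthogonal_comp by (auto intro: subspace_neg)
    moreover have "A \<subseteq> N" by (auto simp: A_def N_def axis_def)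
    moreover have "N \<subseteq> (\<Union>u\<in>W\<^sup>\<bottom>. \<Union>x\<in>N. {u + x})"
    proof
      fix x assume "x \<in> N"
      from sum[OF subspace_0[OF subspace_orthogonal_comp] this]
      show "x \<in> (\<Union>u\<in>W\<^sup>\<bottom>. \<Union>x\<in>N. {u + x})" by simp
    qed
    ultimately show "G \<subseteq> (\<Union>u\<in>W\<^sup>\<bottom>. \<Union>x\<in>N. {u + x})"
      unfolding G_def by (meson Un_least order_trans)
  qed
  ultimately obtain u x where "u \<in> W\<^sup>\<bottom>" "x \<in> N" "c = u + x" by blast
  then show thesis
    using that[of "- u"] subspace_neg[OF subspace_orthogonal_comp] by (auto simp: N_def)
qed

text \<open>Primal optimality makes \<open>c\<close> nonnegative on the feasible directions at
  \<open>x\<close>. Farkas then gives a dual feasible \<open>u + c\<close> vanishing off the zero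
  set of \<open>x\<close>, so its gap \<open>(u + c) \<bullet> x\<close> is 0. Dual optimality of
  \<open>s\<close> forces \<open>s \<bullet> x \<le> 0\<close>, a sum of nonnegative terms.\<close>

lemma complementary_slackness:
  fixes W :: "(real ^ 'n) set"
  assumes W: "subspace W" and x: "lp_primal_optimal W x c x" and s: "lp_dual_optimal W x c s"
  shows "x $ j * s $ j = 0"
proof -
  define J where "J = {j. x $ j = 0}"
  have xn: "0 \<le> x $ k" for k
    using x by (auto simp: lp_primal_optimal_def lp_primal_feasible_def)
  have sn: "0 \<le> s $ k" for k
    using s by (auto simp: lp_dual_optimal_def lp_dual_feasible_def)
  have "0 \<le> c \<bullet> w" if w: "w \<in> W" and wJ: "\<And>j. j \<in> J \<Longrightarrow> 0 \<le> w $ j" for w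
  proof -
    have "\<exists>e>0. \<forall>k. 0 \<le> x $ k + e * w $ k"
    proof -
      \<comment> \<open>Zero entries of \<open>x\<close> move in a nonnegative direction; positive
        ones stay positive for small \<open>e\<close> by continuity.\<close>
      have "\<forall>\<^sub>F e in at_right 0. 0 \<le> x $ k + e * w $ k" for k
      proof (cases "k \<in> J")
        case True
        then show ?thesis
          using wJ by (auto simp: J_def eventually_at_right_field intro!: exI[of _ 1])
      next
        case False
        have "((\<lambda>e. x $ k + e * w $ k) \<longlongrightarrow> x $ k + 0 * w $ k) (at_right 0)"
          by (intro tendsto_intros)
        moreover have "0 < x $ k + 0 * w $ k"
          using False xn[of k] by (simp add: J_def)
        ultimately have "\<forall>\<^sub>F e in at_right 0. 0 < x $ k + e * w $ k"
          by (rule order_tendstoD)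
        then show ?thesis by eventually_elim simp
      qed
      then have "\<forall>\<^sub>F e in at_right 0. \<forall>k. 0 \<le> x $ k + e * w $ k"
        by (rule eventually_all_finite)
      then have "\<forall>\<^sub>F e in at_right (0::real). 0 < e \<and> (\<forall>k. 0 \<le> x $ k + e * w $ k)"
        using eventually_at_right_less[of "0::real"] by eventually_elim simp
      then show ?thesis
        using eventually_happens' trivial_limit_at_right_real by blast
    qed
    then obtain e where e: "e > 0" "\<And>k. 0 \<le> x $ k + e * w $ k" by blast
    have "e *\<^sub>R w + x \<in> lp_primal_feasible W x"
      using e w W by (auto simp: lp_primal_feasible_def subspace_scale add.commute)
    then have "c \<bullet> x \<le> c \<bullet> (e *\<^sub>R w + x)"
      using x by (simp add: lp_primal_optimal_def)
    then show ?thesis using e by (simp add: inner_right_distrib zero_le_mult_iff)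
  qed
  then obtain u where u: "u \<in> W\<^sup>\<bottom>" "\<And>j. j \<in> J \<Longrightarrow> 0 \<le> (u + c) $ j"
      "\<And>j. j \<notin> J \<Longrightarrow> (u + c) $ j = 0"
    using farkas_subspace[OF W, of J c] by blast
  have "0 \<le> (u + c) $ k" for k
    using u(2)[of k] u(3)[of k] by (cases "k \<in> J") auto
  then have "u + c \<in> lp_dual_feasible W c"
    using u(1) by (auto simp: lp_dual_feasible_def)
  then have "s \<bullet> x \<le> (u + c) \<bullet> x"
    using s by (auto simp: lp_dual_optimal_def inner_diff_left)
  also have "(u + c) \<bullet> x = (\<Sum>k\<in>UNIV. (u + c) $ k * x $ k)"
    by (simp only: inner_vec_def inner_real_def)
  also have "\<dots> = 0"
    using u(3) by (intro sum.neutral) (auto simp: J_def simp del: vector_add_component)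
  finally have "(\<Sum>k\<in>UNIV. s $ k * x $ k) \<le> 0"
    by (simp add: inner_vec_def)
  moreover have "0 \<le> (\<Sum>k\<in>UNIV. s $ k * x $ k)"
    using sn xn by (simp add: sum_nonneg)
  ultimately have "(\<Sum>k\<in>UNIV. s $ k * x $ k) = 0" by simp
  then show ?thesis
    using sn xn by (subst (asm) sum_nonneg_eq_0_iff) (auto simp: mult.commute)
qed

section \<open>Exchange along an elementary vector of \<open>W\<^sup>\<bottom>\<close>\<close>

theorem theorem6p4:
  fixes W :: "(real ^ 'n) set" and c d xt s :: "real ^ 'n" and R :: "'n set"
  assumes "subspace W"
    and "lp_primal_optimal W xt c xt"
    and "lp_dual_optimal W xt c s"
    and "R = {i. xt $ i > (kappa W + 1) * norm_l1 (orth_proj (W\<^sup>\<bottom>) (xt - d))}"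
  shows "\<forall>s'. lp_dual_optimal W d c s' \<longrightarrow> (\<forall>i\<in>R. s' $ i = 0)"
proof (intro allI impI ballI, rule ccontr)
  fix s' i
  assume s': "lp_dual_optimal W d c s'" and i: "i \<in> R" and "s' $ i \<noteq> 0"
  have V: "subspace (W\<^sup>\<bottom>)" by (rule subspace_orthogonal_comp)
  define p where "p = orth_proj (W\<^sup>\<bottom>) (xt - d)"
  have p: "xt - d - p \<in> W\<^sup>\<bottom>\<^sup>\<bottom>"
    using theI'[OF orth_proj_ex1[OF V, of "xt - d"]] by (simp add: p_def orth_proj_def)
  have p0: "0 \<le> norm_l1 p" by (simp add: norm_l1_def sum_nonneg)
  have kappa: "1 \<le> kappa W" by (rule one_le_kappa[OF assms(1)])
  have xi: "(kappa W + 1) * norm_l1 p < xt $ i" using i assms(4) by (simp add: p_def)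
  moreover have "0 \<le> (kappa W + 1) * norm_l1 p" using kappa p0 by simp
  ultimately have "xt $ i > 0" by linarith
  note slack = complementary_slackness[OF assms(1-3)]
  have xn: "0 \<le> xt $ k" for k
    using assms(2) by (auto simp: lp_primal_optimal_def lp_primal_feasible_def)
  have sn: "0 \<le> s $ k" "0 \<le> s' $ k" for k
    using assms(3) s' by (auto simp: lp_dual_optimal_def lp_dual_feasible_def)
  obtain u u' where u: "u \<in> W\<^sup>\<bottom>" "s = u + c" "u' \<in> W\<^sup>\<bottom>" "s' = u' + c"
    using assms(3) s' by (auto simp: lp_dual_optimal_def lp_dual_feasible_def)
  have "s $ i = 0" using slack[of i] \<open>xt $ i > 0\<close> by simp
  then have "(s' - s) $ i > 0" using \<open>s' $ i \<noteq> 0\<close> sn(2)[of i] by simp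
  moreover have "s' - s \<in> W\<^sup>\<bottom>" using u V by (simp add: subspace_diff)
  ultimately obtain h where h: "elementary_vector (W\<^sup>\<bottom>) h" and hi: "h $ i > 0"
    and le: "\<And>k. h $ k \<le> max ((s' - s) $ k) 0"
    and neg: "\<And>k. h $ k < 0 \<Longrightarrow> (s' - s) $ k < 0"
    using ex_dominated_conformal_elementary[OF V] by metis
  have hV: "h \<in> W\<^sup>\<bottom>" using h by (simp add: elementary_vector_def)
  \<comment> \<open>As \<open>s\<close> and \<open>s'\<close> are nonnegative,
    \<open>max ((s' - s) $ k) 0\<close> is at most \<open>s' $ k\<close>.\<close>
  have "0 \<le> (s' - h) $ k" for k
    using le[of k] sn[of k] by (simp add: max_def split: if_splits)
  moreover have "s' - h = (u' - h) + c" "u' - h \<in> W\<^sup>\<bottom>"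
    using u hV V by (auto simp: subspace_diff)
  ultimately have "s' - h \<in> lp_dual_feasible W c"
    unfolding lp_dual_feasible_def by blast
  then have "(c - (s' - h)) \<bullet> d \<le> (c - s') \<bullet> d"
    using s' by (simp add: lp_dual_optimal_def)
  then have hd: "h \<bullet> d \<le> 0" by (simp add: inner_diff_left)
  have "h $ i * xt $ i \<le> (\<Sum>k\<in>UNIV. h $ k * xt $ k)"
  proof (rule member_le_sum)
    fix k
    show "0 \<le> h $ k * xt $ k"
    proof (cases "h $ k < 0")
      case True
      then have "s $ k > 0" using neg[OF True] sn[of k] by simp
      then show ?thesis using slack[of k] by simp
    next
      case False
      then show ?thesis using xn[of k] by simp
    qed
  qed auto
  \<comment> \<open>The residual of the projection is orthogonal to \<open>h\<close>, so only
    \<open>p\<close> contributes to \<open>h \<bullet> (xt - d)\<close>.\<close>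
  also have "\<dots> = h \<bullet> d + h \<bullet> (xt - d - p) + h \<bullet> p"
    by (simp add: inner_diff_right flip: inner_vec_def[of h xt, unfolded inner_real_def])
  also have "h \<bullet> (xt - d - p) = 0"
    using orthogonal_compD[OF p hV] by (simp add: inner_commute)
  also have "h \<bullet> p \<le> (kappa W * h $ i) * norm_l1 p"
  proof (rule inner_le_norm_l1)
    fix k
    show "\<bar>h $ k\<bar> \<le> kappa W * h $ i"
    proof (cases "k \<in> vsupp h")
      case True
      then have "\<bar>h $ k / h $ i\<bar> \<le> kappa W"
        using elementary_ratio_orthogonal_comp_le_kappa[OF assms(1) h, of i k] hi by (simp add: vsupp_def)
      then show ?thesis using hi by (simp add: abs_divide pos_divide_le_eq)
    next
      case False
      then show ?thesis using kappa hi by (simp add: vsupp_def)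
    qed
  qed
  finally have "h $ i * xt $ i \<le> h $ i * (kappa W * norm_l1 p)"
    using hd by (simp add: algebra_simps)
  then have "xt $ i \<le> kappa W * norm_l1 p" using hi by simp
  with xi p0 show False by (simp add: algebra_simps)
qed

end
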